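(* Let $m,n$ be positive integers. If $X\in\mathbb{R}^{m\times n}$ is a generic matrix of rank $r<\min\{m,n\}$ and $\pi$ is a permutation of the $mn$ entries of $m\times n$ matrices, then $\operatorname{rank}(\pi(X))>r$, except when $\pi(X)=\Pi_1X\Pi_2$ for permutation matrices $\Pi_1$ (of size $m\times m$) and $\Pi_2$ (of size $n\times n$), or when $\pi(X)=X^\top$ in case $m=n$.
   Context: For a permutation $\pi$ in the group of all $(mn)!$ permutations of the coordinates of $\mathbb{R}^{m\times n}$, $\pi(X)$ is the $m\times n$ matrix obtained from $X$ by permuting its entries according to $\pi$. Let $\mathcal{M}_{r,m\times n}=\{W\in\mathbb{R}^{m\times n}:\operatorname{rank}(W)\le r\}$, an irreducible algebraic variety, with the Zariski topology, whose closed sets are the subsets cut out by real polynomial equations in the $mn$ entries. "A generic matrix of rank $r$ satisfies P" means that there is a non-empty Zariski-open subset of $\mathcal{M}_{r,m\times n}$ such that P holds for every rank-$r$ matrix $X$ in it; here a single such open set serves for all permutations $\pi$.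
   Formalization: For m=n the exception π(X)=X^T is widened to π(X)=Π1 X^T Π2 with permutation matrices Π1, Π2; as written the claim fails, e.g. for generic 2×2 rank-1 X and π = transposition followed by a row swap. *)

theory Defs
  imports "Jordan_Normal_Form.DL_Rank" "HOL-Combinatorics.Permutations"
begin

abbreviation mat_rank :: "real mat \<Rightarrow> nat" where
  "mat_rank X \<equiv> vec_space.rank (dim_row X) X"

(* Real polynomials in the m * n entries, represented as functions of the matrix.
   Only the values on carrier_mat m n matter. *)
inductive_set entry_polynomials :: "nat \<Rightarrow> nat \<Rightarrow> (real mat \<Rightarrow> real) set"
  for m n :: nat where
  const: "(\<lambda>X. c) \<in> entry_polynomials m n"
| entry: "i < m \<Longrightarrow> j < n \<Longrightarrow> (\<lambda>X. X $$ (i, j)) \<in> entry_polynomials m n"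
| add: "f \<in> entry_polynomials m n \<Longrightarrow> g \<in> entry_polynomials m n \<Longrightarrow>
    (\<lambda>X. f X + g X) \<in> entry_polynomials m n"
| mult: "f \<in> entry_polynomials m n \<Longrightarrow> g \<in> entry_polynomials m n \<Longrightarrow>
    (\<lambda>X. f X * g X) \<in> entry_polynomials m n"

definition zariski_closed :: "nat \<Rightarrow> nat \<Rightarrow> real mat set \<Rightarrow> bool" where
  "zariski_closed m n Z \<longleftrightarrow>
    (\<exists>F \<subseteq> entry_polynomials m n. Z = {X \<in> carrier_mat m n. \<forall>f\<in>F. f X = 0})"

definition zariski_open_in :: "nat \<Rightarrow> nat \<Rightarrow> real mat set \<Rightarrow> real mat set \<Rightarrow> bool" where
  "zariski_open_in m n V U \<longleftrightarrow> (\<exists>Z. zariski_closed m n Z \<and> U = V - Z)"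

definition rank_variety :: "nat \<Rightarrow> nat \<Rightarrow> nat \<Rightarrow> real mat set" where
  "rank_variety r m n = {W \<in> carrier_mat m n. mat_rank W \<le> r}"

definition generic_of_rank :: "nat \<Rightarrow> nat \<Rightarrow> nat \<Rightarrow> (real mat \<Rightarrow> bool) \<Rightarrow> bool" where
  "generic_of_rank r m n P \<longleftrightarrow>
    (\<exists>U. zariski_open_in m n (rank_variety r m n) U \<and> U \<noteq> {} \<and>
      (\<forall>X\<in>U. mat_rank X = r \<longrightarrow> P X))"

definition permute_entries :: "(nat \<times> nat \<Rightarrow> nat \<times> nat) \<Rightarrow> real mat \<Rightarrow> real mat" where
  "permute_entries \<pi> X = mat (dim_row X) (dim_col X) (\<lambda>ij. X $$ \<pi> ij)"

definition permutation_matrix :: "nat \<Rightarrow> real mat \<Rightarrow> bool" where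
  "permutation_matrix k P \<longleftrightarrow>
    (\<exists>\<sigma>. \<sigma> permutes {..<k} \<and> P = mat k k (\<lambda>(i, j). if j = \<sigma> i then 1 else 0))"

end

theory Submission
  imports Defs "HOL-Computational_Algebra.Polynomial"
begin

text \<open>
  A permutation of the cells under which non-collinear cells (different row and different
  column) stay non-collinear is an automorphism of the rook graph, hence a row and column
  permutation, possibly composed with the transposition. Any other \<open>\<pi>\<close> sends some two
  non-collinear cells to collinear ones. Extend them to a transversal of \<open>r + 1\<close> cells and let
  \<open>X\<close> be the 0-1 matrix supported on its image: the \<open>r + 1\<close> ones lie in at most \<open>r\<close> rows or at
  most \<open>r\<close> columns, so \<open>X\<close> has rank at most \<open>r\<close>, whereas \<open>\<pi>(X)\<close> has an identity minor of
  size \<open>r + 1\<close>. The corresponding minor of \<open>\<pi>(X)\<close> is thus a polynomial not vanishing on the rank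
  variety, and by irreducibility the product over the finitely many such \<open>\<pi>\<close> does not vanish
  either.
\<close>

section \<open>Rank and sums of products\<close>

text \<open>The product of an \<open>m\<close> by \<open>r\<close> and an \<open>r\<close> by
  \<open>n\<close> factor. Plain index functions let the factors be interpolated and reindexed
  without carrier conditions.\<close>

definition sum_of_products :: "nat \<Rightarrow> nat \<Rightarrow> nat \<Rightarrow> (nat \<Rightarrow> nat \<Rightarrow> real) \<Rightarrow> (nat \<Rightarrow> nat \<Rightarrow> real) \<Rightarrow> real mat"
  where "sum_of_products r m n c d = mat m n (\<lambda>(i, j). \<Sum>k<r. c i k * d k j)"

lemma sum_of_products_carrier [simp]: "sum_of_products r m n c d \<in> carrier_mat m n"
  by (simp add: sum_of_products_def)

text \<open>Each \<open>k\<close> contributes an outer product, of rank at most 1, and rank is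
  subadditive.\<close>

lemma rank_sum_of_products_le: "vec_space.rank m (sum_of_products r m n c d) \<le> r"
proof (induction r)
  case 0
  have "sum_of_products 0 m n c d = 0\<^sub>m m n"
    by (auto simp: sum_of_products_def)
  then show ?case by (simp add: vec_space.rank_0I)
next
  case (Suc r)
  let ?A = "sum_of_products r m n c d" and ?B = "mat m n (\<lambda>(i, j). c i r * d r j)"
  have "sum_of_products (Suc r) m n c d = ?A + ?B"
    by (auto simp: sum_of_products_def)
  moreover have "vec_space.rank m (?A + ?B) \<le> vec_space.rank m ?A + vec_space.rank m ?B"
    by (rule vec_space.rank_subadditive) auto
  moreover have "vec_space.rank m ?B \<le> 1"
    by (rule vec_space.rank_le_1_product_entries[where f = "\<lambda>i. c i r" and g = "d r"]) auto
  ultimately show ?case using Suc by simp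
qed

text \<open>Rank factorisation: a maximal independent set of columns gives the left factor, the
  coordinates of each column in it give the right factor.\<close>

lemma (in vec_space) rank_le_imp_sum_of_products:
  assumes A: "A \<in> carrier_mat n nc" and r: "rank A \<le> r"
  shows "\<exists>c d. \<forall>i<n. \<forall>j<nc. A $$ (i, j) = (\<Sum>k<r. c i k * d k j)"
proof -
  let ?P = "\<lambda>T. T \<subseteq> set (cols A) \<and> lin_indpt T"
  have cols: "set (cols A) \<subseteq> carrier_vec n" using A cols_dim by blast
  obtain S where S: "maximal S ?P" "finite S"
    using maximal_exists_superset[of "set (cols A)" ?P "{}"] finite_lin_indpt2[of "{}"] by auto
  then have sub: "S \<subseteq> set (cols A)" and indpt: "lin_indpt S"
    by (auto simp: maximal_def)
  have in_span: "v \<in> span S" if v: "v \<in> set (cols A)" for v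
  proof (rule ccontr)
    assume "v \<notin> span S"
    moreover from this have "v \<notin> S" using in_own_span sub cols by blast
    ultimately have "lin_indpt (S \<union> {v})"
      using lin_dep_iff_in_span[of S v] sub cols indpt v by blast
    with S(1) sub v \<open>v \<notin> S\<close> show False unfolding maximal_def by blast
  qed
  have "card S \<le> r"
    using rank_card_indpt[OF A S(1)] r by simp
  obtain s where s: "bij_betw s {..<card S} S"
    using ex_bij_betw_nat_finite[OF S(2)] by (auto simp: atLeast0LessThan)
  have "\<exists>a. \<forall>i<n. A $$ (i, j) = (\<Sum>k<card S. s k $ i * a k)" if j: "j < nc" for j
  proof -
    have "col A j \<in> set (cols A)" using j A by (auto simp: cols_def)
    then obtain a where a: "col A j = lincomb a S"
      using in_span finite_in_span[OF S(2), of "col A j"] sub cols by (metis subset_trans)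
    have "A $$ (i, j) = (\<Sum>k<card S. s k $ i * a (s k))" if i: "i < n" for i
    proof -
      have "A $$ (i, j) = col A j $ i" using A i j by auto
      also have "\<dots> = (\<Sum>v\<in>S. a v * v $ i)"
        unfolding a using sub cols i by (intro lincomb_index) auto
      also have "\<dots> = (\<Sum>k<card S. a (s k) * s k $ i)"
        by (rule sum.reindex_bij_betw[OF s, symmetric])
      finally show ?thesis by (simp add: mult.commute)
    qed
    then show ?thesis by (intro exI[of _ "\<lambda>k. a (s k)"]) simp
  qed
  then obtain a where a: "\<And>i j. i < n \<Longrightarrow> j < nc \<Longrightarrow> A $$ (i, j) = (\<Sum>k<card S. s k $ i * a j k)"
    by metis
  \<comment> \<open>The basis may have fewer than \<open>r\<close> columns; zero columns pad the
    left factor.\<close>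
  have "A $$ (i, j) = (\<Sum>k<r. (if k < card S then s k $ i else 0) * a j k)"
    if "i < n" "j < nc" for i j
    unfolding a[OF that] using \<open>card S \<le> r\<close>
    by (intro sum.mono_neutral_cong_left) auto
  then show ?thesis
    by (intro exI[of _ "\<lambda>i k. if k < card S then s k $ i else 0"] exI[of _ "\<lambda>k j. a j k"]) simp
qed

lemma rank_variety_iff:
  "X \<in> rank_variety r m n \<longleftrightarrow> (\<exists>c d. X = sum_of_products r m n c d)"
proof
  assume "X \<in> rank_variety r m n"
  then have X: "X \<in> carrier_mat m n" and "vec_space.rank m X \<le> r"
    by (auto simp: rank_variety_def)
  from vec_space.rank_le_imp_sum_of_products[OF this]
  obtain c d where "\<forall>i<m. \<forall>j<n. X $$ (i, j) = (\<Sum>k<r. c i k * d k j)" by blast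
  then have "X = sum_of_products r m n c d"
    using X by (auto simp: sum_of_products_def)
  then show "\<exists>c d. X = sum_of_products r m n c d" by blast
next
  assume "\<exists>c d. X = sum_of_products r m n c d"
  then obtain c d where "X = sum_of_products r m n c d" by blast
  then show "X \<in> rank_variety r m n"
    using rank_sum_of_products_le[of m r n c d]
      carrier_matD(1)[OF sum_of_products_carrier, of r m n c d]
    by (simp add: rank_variety_def)
qed

text \<open>A factorisation of \<open>Y\<close> through \<open>r\<close> restricts to any selected
  rows and columns, so it would force every minor of size \<open>r + 1\<close> to vanish.\<close>

lemma det_nonzero_imp_rank_gt:
  assumes Y: "Y \<in> carrier_mat m n"
    and f: "\<And>k. k \<le> r \<Longrightarrow> f k < m" and g: "\<And>k. k \<le> r \<Longrightarrow> g k < n"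
    and det: "det (mat (Suc r) (Suc r) (\<lambda>(k, l). Y $$ (f k, g l))) \<noteq> 0"
  shows "mat_rank Y > r"
proof (rule ccontr)
  let ?Z = "mat (Suc r) (Suc r) (\<lambda>(k, l). Y $$ (f k, g l))"
  assume "\<not> mat_rank Y > r"
  then have "Y \<in> rank_variety r m n" using Y by (simp add: rank_variety_def)
  then obtain c d where cd: "Y = sum_of_products r m n c d" using rank_variety_iff by blast
  have "?Z = sum_of_products r (Suc r) (Suc r) (\<lambda>k. c (f k)) (\<lambda>h l. d h (g l))"
    unfolding sum_of_products_def
    by (rule cong_mat) (auto simp: cd sum_of_products_def f g less_Suc_eq_le)
  then have "vec_space.rank (Suc r) ?Z \<le> r"
    using rank_sum_of_products_le[of "Suc r" r "Suc r"] by simp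
  moreover have "vec_space.rank (Suc r) ?Z = Suc r"
    using vec_space.low_rank_det_zero[of ?Z "Suc r"] det by auto
  ultimately show False by simp
qed

section \<open>Irreducibility of the rank variety\<close>

lemma entry_polynomials_sum:
  "finite A \<Longrightarrow> (\<And>a. a \<in> A \<Longrightarrow> f a \<in> entry_polynomials m n) \<Longrightarrow>
    (\<lambda>X. \<Sum>a\<in>A. f a X) \<in> entry_polynomials m n"
  by (induction A rule: finite_induct) (auto intro: entry_polynomials.intros)

lemma entry_polynomials_prod:
  "finite A \<Longrightarrow> (\<And>a. a \<in> A \<Longrightarrow> f a \<in> entry_polynomials m n) \<Longrightarrow>
    (\<lambda>X. \<Prod>a\<in>A. f a X) \<in> entry_polynomials m n"
  by (induction A rule: finite_induct) (auto intro: entry_polynomials.intros)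

lemma entry_polynomials_det:
  assumes "\<And>k l. k < q \<Longrightarrow> l < q \<Longrightarrow> f k l \<in> entry_polynomials m n"
  shows "(\<lambda>X. det (mat q q (\<lambda>(k, l). f k l X))) \<in> entry_polynomials m n"
proof -
  have "(\<lambda>X. det (mat q q (\<lambda>(k, l). f k l X))) =
    (\<lambda>X. \<Sum>p\<in>{p. p permutes {0..<q}}. signof p * (\<Prod>i = 0..<q. f i (p i) X))"
    by (intro ext, subst det_def'[of _ q]) (auto intro!: sum.cong prod.cong)
  moreover have "\<dots> \<in> entry_polynomials m n"
    by (intro entry_polynomials_sum entry_polynomials.mult entry_polynomials.const
        entry_polynomials_prod assms finite_permutations) auto
  ultimately show ?thesis by simp
qed

text \<open>Restriction to a polynomial curve reduces nonvanishing on the variety to nonvanishing of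
  a univariate polynomial.\<close>

lemma entry_polynomials_on_curve:
  assumes "f \<in> entry_polynomials m n"
    and "\<And>i j. i < m \<Longrightarrow> j < n \<Longrightarrow> \<exists>p. \<forall>t. X t $$ (i, j) = poly p t"
  shows "\<exists>p. \<forall>t. f (X t) = poly p t"
  using assms(1)
proof (induction rule: entry_polynomials.induct)
  case (const c)
  show ?case by (rule exI[of _ "[:c:]"]) simp
next
  case (entry i j)
  then show ?case by (rule assms(2))
next
  case (add f g)
  then obtain p q where "\<And>t. f (X t) = poly p t" "\<And>t. g (X t) = poly q t" by blast
  then show ?case by (intro exI[of _ "p + q"]) simp
next
  case (mult f g)
  then obtain p q where "\<And>t. f (X t) = poly p t" "\<And>t. g (X t) = poly q t" by blast
  then show ?case by (intro exI[of _ "p * q"]) simp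
qed

text \<open>Two points of the variety lie on the polynomial curve obtained by joining
  their factorisations by a line; a product of nonzero univariate polynomials is nonzero.\<close>

lemma rank_variety_irreducible:
  assumes f: "f \<in> entry_polynomials m n" and g: "g \<in> entry_polynomials m n"
    and X: "X \<in> rank_variety r m n" "f X \<noteq> 0" and Y: "Y \<in> rank_variety r m n" "g Y \<noteq> 0"
  shows "\<exists>Z \<in> rank_variety r m n. f Z * g Z \<noteq> 0"
proof -
  obtain c d c' d' where cd: "X = sum_of_products r m n c d" "Y = sum_of_products r m n c' d'"
    using X Y rank_variety_iff by metis
  \<comment> \<open>The segment from \<open>X\<close> to \<open>Y\<close> itself could leave the
    variety. Interpolating the factors keeps the inner dimension \<open>r\<close>, and the entries
    have degree at most 2 in \<open>t\<close>.\<close>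
  define Z where "Z t = sum_of_products r m n (\<lambda>i k. c i k + t * (c' i k - c i k))
    (\<lambda>k j. d k j + t * (d' k j - d k j))" for t
  have curve: "\<exists>p. \<forall>t. Z t $$ (i, j) = poly p t" if "i < m" "j < n" for i j
    using that
    by (intro exI[of _ "\<Sum>k<r. [:c i k, c' i k - c i k:] * [:d k j, d' k j - d k j:]"])
      (simp only: poly_sum poly_mult, simp add: Z_def sum_of_products_def)
  obtain p where p: "\<And>t. f (Z t) = poly p t"
    using entry_polynomials_on_curve[of f m n Z] f curve by blast
  obtain q where q: "\<And>t. g (Z t) = poly q t"
    using entry_polynomials_on_curve[of g m n Z] g curve by blast
  have "Z 0 = X" "Z 1 = Y" by (simp_all add: Z_def cd)
  then have "poly p 0 \<noteq> 0" "poly q 1 \<noteq> 0"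
    using p[of 0] q[of 1] X Y by simp_all
  then have "p * q \<noteq> 0" by auto
  then obtain t where "poly (p * q) t \<noteq> 0" using poly_all_0_iff_0 by blast
  then have "f (Z t) * g (Z t) \<noteq> 0" by (simp add: p q)
  moreover have "Z t \<in> rank_variety r m n" unfolding Z_def rank_variety_iff by blast
  ultimately show ?thesis by blast
qed

text \<open>Irreducibility, iterated: finitely many nonempty nonvanishing loci have a common point.
  This is what yields one open set for all permutations.\<close>

lemma rank_variety_prod_nonzero:
  assumes "finite A" and "\<And>a. a \<in> A \<Longrightarrow> f a \<in> entry_polynomials m n"
    and "\<And>a. a \<in> A \<Longrightarrow> \<exists>X \<in> rank_variety r m n. f a X \<noteq> 0"
  shows "\<exists>X \<in> rank_variety r m n. (\<Prod>a\<in>A. f a X) \<noteq> 0"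
  using assms
proof (induction A rule: finite_induct)
  case empty
  have "sum_of_products r m n (\<lambda>_ _. 0) (\<lambda>_ _. 0) \<in> rank_variety r m n"
    unfolding rank_variety_iff by blast
  then show ?case by auto
next
  case (insert a A)
  have "(\<lambda>X. \<Prod>a\<in>A. f a X) \<in> entry_polynomials m n"
    using insert by (intro entry_polynomials_prod) auto
  moreover have "f a \<in> entry_polynomials m n" using insert by simp
  moreover obtain X where "X \<in> rank_variety r m n" "f a X \<noteq> 0"
    using insert.prems(2)[of a] by auto
  moreover obtain Y where "Y \<in> rank_variety r m n" "(\<Prod>a\<in>A. f a Y) \<noteq> 0"
    using insert.IH insert.prems by auto
  ultimately have "\<exists>Z \<in> rank_variety r m n. f a Z * (\<Prod>a\<in>A. f a Z) \<noteq> 0"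
    by (intro rank_variety_irreducible)
  then show ?case using insert.hyps by simp
qed

section \<open>Permutations of a grid and lines\<close>

text \<open>Equal or adjacent in the rook graph of the grid.\<close>

definition collinear :: "nat \<times> nat \<Rightarrow> nat \<times> nat \<Rightarrow> bool"
  where "collinear p q \<longleftrightarrow> fst p = fst q \<or> snd p = snd q"

text \<open>\<open>\<pi>\<close> injects the finite set of noncollinear pairs into itself, hence
  maps it onto itself; this gives the converse of \<open>pres\<close>.\<close>

lemma collinear_iff_permutes:
  assumes perm: "\<pi> permutes G" and fin: "finite G"
    and pres: "\<And>p q. p \<in> G \<Longrightarrow> q \<in> G \<Longrightarrow> collinear (\<pi> p) (\<pi> q) \<Longrightarrow> collinear p q"
    and pq: "p \<in> G" "q \<in> G"
  shows "collinear (\<pi> p) (\<pi> q) \<longleftrightarrow> collinear p q"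
proof -
  define N where "N = {(p, q) \<in> G \<times> G. \<not> collinear p q}"
  let ?h = "map_prod \<pi> \<pi>"
  have "finite N" using fin by (auto simp: N_def intro: finite_subset[of _ "G \<times> G"])
  moreover have sub: "?h ` N \<subseteq> N"
    using pres permutes_in_image[OF perm] by (auto simp: N_def)
  moreover have inj: "inj ?h" using permutes_inj[OF perm] by (simp add: prod.inj_map)
  ultimately have "?h ` N = N"
    by (intro endo_inj_surj) (auto intro: inj_on_subset)
  then have "?h (p, q) \<in> N \<longleftrightarrow> (p, q) \<in> N"
    using inj by (metis inj_image_mem_iff)
  then show ?thesis using pq permutes_in_image[OF perm] by (auto simp: N_def)
qed

text \<open>Two cells of a line are sent to a common row or a common column. Corners carry this
  choice from one line to the next, so either all lines keep their direction or all are
  turned.\<close>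

lemma grid_collinear_automorphism:
  fixes \<pi> :: "nat \<times> nat \<Rightarrow> nat \<times> nat"
  assumes m: "2 \<le> m" and n: "2 \<le> n"
    and col: "\<And>p q. p \<in> {..<m} \<times> {..<n} \<Longrightarrow> q \<in> {..<m} \<times> {..<n} \<Longrightarrow>
      collinear (\<pi> p) (\<pi> q) \<longleftrightarrow> collinear p q"
  shows "\<exists>s t. (\<forall>i<m. \<forall>j<n. \<pi> (i, j) = (s i, t j)) \<or> (\<forall>i<m. \<forall>j<n. \<pi> (i, j) = (t j, s i))"
proof -
  define H where "H i j j' \<longleftrightarrow> fst (\<pi> (i, j)) = fst (\<pi> (i, j'))" for i j j'
  define V where "V i i' j \<longleftrightarrow> snd (\<pi> (i, j)) = snd (\<pi> (i', j))" for i i' j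
  have row: "fst (\<pi> (i, j)) = fst (\<pi> (i, j')) \<or> snd (\<pi> (i, j)) = snd (\<pi> (i, j'))"
    if "i < m" "j < n" "j' < n" for i j j'
    using col[of "(i, j)" "(i, j')"] that by (simp add: collinear_def)
  have column: "fst (\<pi> (i, j)) = fst (\<pi> (i', j)) \<or> snd (\<pi> (i, j)) = snd (\<pi> (i', j))"
    if "i < m" "i' < m" "j < n" for i i' j
    using col[of "(i, j)" "(i', j)"] that by (simp add: collinear_def)
  have diag: "fst (\<pi> (i, j)) \<noteq> fst (\<pi> (i', j')) \<and> snd (\<pi> (i, j)) \<noteq> snd (\<pi> (i', j'))"
    if "i < m" "i' < m" "j < n" "j' < n" "i \<noteq> i'" "j \<noteq> j'" for i i' j j'
    using col[of "(i, j)" "(i', j')"] that by (simp add: collinear_def)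
  \<comment> \<open>At the corner \<open>(i, j)\<close>, keeping the direction of one arm and
    turning the other would place the images of \<open>(i, j')\<close> and \<open>(i', j)\<close> on
    a common line, against \<open>diag\<close>.\<close>
  have HV: "H i j j' \<longleftrightarrow> V i i' j"
    if "i < m" "i' < m" "j < n" "j' < n" "i \<noteq> i'" "j \<noteq> j'" for i i' j j'
    using row[of i j j'] column[of i i' j] diag[of i' i j j'] that
    unfolding H_def V_def by metis
  have other: "\<exists>l<k. l \<noteq> j" if "2 \<le> k" for j k :: nat
    using that by (intro exI[of _ "if j = 0 then 1 else 0"]) auto
  have H_const: "H i j j' \<longleftrightarrow> H 0 0 1"
    if ij: "i < m" "j < n" "j' < n" "j \<noteq> j'" for i j j'
  proof -
    \<comment> \<open>\<open>V i i' j\<close> does not mention \<open>j'\<close>, so by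
      \<open>HV\<close> the second column may be replaced; the symmetry of \<open>H\<close> then
      moves both columns.\<close>
    have move_j: "H i j j' \<longleftrightarrow> H i l l'"
      if "i < m" "j < n" "j' < n" "j \<noteq> j'" "l < n" "l' < n" "l \<noteq> l'" for i j j' l l'
    proof -
      obtain i' where "i' < m" "i' \<noteq> i" using other[OF m] by blast
      then have 1: "H i j j' \<longleftrightarrow> H i j k" if "j < n" "j' < n" "j \<noteq> j'" "k < n" "k \<noteq> j" for j j' k
        using HV[of i i' j j'] HV[of i i' j k] that \<open>i < m\<close> by metis
      have 2: "H i j j' \<longleftrightarrow> H i j' j" for j j' by (auto simp: H_def)
      show ?thesis using 1 2 that by metis
    qed
    \<comment> \<open>The cells \<open>(i, 0)\<close> and \<open>(0, 0)\<close> form a common arm of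
      the corners in rows \<open>i\<close> and \<open>0\<close>.\<close>
    have "H i 0 1 \<longleftrightarrow> H 0 0 1"
    proof (cases "i = 0")
      case False
      then show ?thesis
        using HV[of i 0 0 1] HV[of 0 i 0 1] ij m n by (auto simp: V_def)
    qed simp
    then show ?thesis using move_j[of i j j' 0 1] ij n by simp
  qed
  have V_const: "V i i' j \<longleftrightarrow> H 0 0 1" if "i < m" "i' < m" "i \<noteq> i'" "j < n" for i i' j
    using other[OF n, of j] HV[of i i' j] H_const[of i j] that by metis
  show ?thesis
  proof (cases "H 0 0 1")
    case True
    \<comment> \<open>All directions are kept, so the two coordinate maps can be read off along
      column 0 and row 0. In the other case the coordinates swap.\<close>
    have "\<pi> (i, j) = (fst (\<pi> (i, 0)), snd (\<pi> (0, j)))" if "i < m" "j < n" for i j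
    proof (rule prod_eqI)
      show "fst (\<pi> (i, j)) = fst (fst (\<pi> (i, 0)), snd (\<pi> (0, j)))"
        using H_const[of i j 0] True that n by (cases "j = 0") (auto simp: H_def)
      show "snd (\<pi> (i, j)) = snd (fst (\<pi> (i, 0)), snd (\<pi> (0, j)))"
        using V_const[of i 0 j] True that m by (cases "i = 0") (auto simp: V_def)
    qed
    then show ?thesis
      by (intro exI[of _ "\<lambda>i. fst (\<pi> (i, 0))"] exI[of _ "\<lambda>j. snd (\<pi> (0, j))"] disjI1 allI impI)
  next
    case False
    have "\<pi> (i, j) = (fst (\<pi> (0, j)), snd (\<pi> (i, 0)))" if "i < m" "j < n" for i j
    proof (rule prod_eqI)
      show "fst (\<pi> (i, j)) = fst (fst (\<pi> (0, j)), snd (\<pi> (i, 0)))"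
        using V_const[of i 0 j] column[of i 0 j] False that m by (cases "i = 0") (auto simp: V_def)
      show "snd (\<pi> (i, j)) = snd (fst (\<pi> (0, j)), snd (\<pi> (i, 0)))"
        using H_const[of i j 0] row[of i j 0] False that n by (cases "j = 0") (auto simp: H_def)
    qed
    then show ?thesis
      by (intro exI[of _ "\<lambda>i. snd (\<pi> (i, 0))"] exI[of _ "\<lambda>j. fst (\<pi> (0, j))"] disjI2 allI impI)
  qed
qed

section \<open>Row and column rearrangements as products with permutation matrices\<close>

lemma inj_on_extend_permutes:
  fixes f :: "nat \<Rightarrow> nat"
  assumes "inj_on f {..<k}" and "f ` {..<k} \<subseteq> {..<k}"
  shows "(\<lambda>i. if i < k then f i else i) permutes {..<k}"
proof (rule bij_imp_permutes)
  have "bij_betw f {..<k} {..<k}"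
    using assms by (simp add: bij_betw_def endo_inj_surj)
  then show "bij_betw (\<lambda>i. if i < k then f i else i) {..<k} {..<k}"
    by (rule bij_betw_cong[THEN iffD1, rotated]) simp
qed auto

lemma permutation_matrix_mult_left:
  assumes s: "\<sigma> permutes {..<m}" and X: "X \<in> carrier_mat m n" and ij: "i < m" "j < n"
  shows "(mat m m (\<lambda>(i, j). if j = \<sigma> i then 1 else 0 :: real) * X) $$ (i, j) = X $$ (\<sigma> i, j)"
proof -
  have "\<sigma> i < m" using permutes_in_image[OF s, of i] ij by simp
  have "(mat m m (\<lambda>(i, j). if j = \<sigma> i then 1 else 0) * X) $$ (i, j) =
    (\<Sum>k = 0..<m. (if k = \<sigma> i then 1 else 0) * X $$ (k, j))"
    using X ij by (auto simp: scalar_prod_def intro!: sum.cong)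
  also have "\<dots> = (\<Sum>k = 0..<m. if k = \<sigma> i then X $$ (k, j) else 0)"
    by (intro sum.cong) auto
  also have "\<dots> = X $$ (\<sigma> i, j)" using \<open>\<sigma> i < m\<close> by (subst sum.delta) auto
  finally show ?thesis .
qed

text \<open>The inverse appears because column \<open>j\<close> of the right factor must have its
  one in row \<open>\<tau> j\<close>.\<close>

lemma permutation_matrix_mult_right:
  assumes t: "\<tau> permutes {..<n}" and X: "X \<in> carrier_mat m n" and ij: "i < m" "j < n"
  shows "(X * mat n n (\<lambda>(i, j). if j = inv_into UNIV \<tau> i then 1 else 0 :: real)) $$ (i, j) = X $$ (i, \<tau> j)"
proof -
  have "\<tau> j < n" using permutes_in_image[OF t, of j] ij by simp
  have inv: "j = inv_into UNIV \<tau> k \<longleftrightarrow> k = \<tau> j" for k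
    using permutes_inv_eq[OF t] by metis
  have "(X * mat n n (\<lambda>(i, j). if j = inv_into UNIV \<tau> i then 1 else 0)) $$ (i, j) =
    (\<Sum>k = 0..<n. X $$ (i, k) * (if k = \<tau> j then 1 else 0))"
    using X ij by (auto simp: scalar_prod_def inv intro!: sum.cong)
  also have "\<dots> = (\<Sum>k = 0..<n. if k = \<tau> j then X $$ (i, k) else 0)"
    by (intro sum.cong) auto
  also have "\<dots> = X $$ (i, \<tau> j)" using \<open>\<tau> j < n\<close> by (subst sum.delta) auto
  finally show ?thesis .
qed

lemma rearrangement_eq_permutation_matrices:
  assumes s: "inj_on \<sigma> {..<m}" "\<sigma> ` {..<m} \<subseteq> {..<m}"
    and t: "inj_on \<tau> {..<n}" "\<tau> ` {..<n} \<subseteq> {..<n}" and X: "X \<in> carrier_mat m n"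
  shows "\<exists>P Q. permutation_matrix m P \<and> permutation_matrix n Q \<and>
    mat m n (\<lambda>(i, j). X $$ (\<sigma> i, \<tau> j)) = P * X * Q"
proof -
  \<comment> \<open>\<open>permutes\<close> demands the identity outside the index range, hence the
    extensions.\<close>
  let ?s = "\<lambda>i. if i < m then \<sigma> i else i" and ?t = "\<lambda>i. if i < n then \<tau> i else i"
  let ?P = "mat m m (\<lambda>(i, j). if j = ?s i then 1 else 0 :: real)"
  let ?Q = "mat n n (\<lambda>(i, j). if j = inv_into UNIV ?t i then 1 else 0 :: real)"
  note s' = inj_on_extend_permutes[OF s] and t' = inj_on_extend_permutes[OF t]
  have PX: "?P * X \<in> carrier_mat m n" by (rule mult_carrier_mat[OF mat_carrier X])
  have "mat m n (\<lambda>(i, j). X $$ (\<sigma> i, \<tau> j)) = ?P * X * ?Q"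
  proof (rule eq_matI)
    fix i j assume "i < dim_row (?P * X * ?Q)" "j < dim_col (?P * X * ?Q)"
    then have ij: "i < m" "j < n" by simp_all
    then have tj: "\<tau> j < n" using t by auto
    show "mat m n (\<lambda>(i, j). X $$ (\<sigma> i, \<tau> j)) $$ (i, j) = (?P * X * ?Q) $$ (i, j)"
      unfolding permutation_matrix_mult_right[OF t' PX ij]
      using permutation_matrix_mult_left[OF s' X ij(1) tj] ij by simp
  qed auto
  moreover have "permutation_matrix m ?P" using s' unfolding permutation_matrix_def by blast
  moreover have "permutation_matrix n ?Q" using permutes_inv[OF t'] unfolding permutation_matrix_def by blast
  ultimately show ?thesis by blast
qed

text \<open>Such a \<open>\<pi>\<close> acts on the two coordinates separately. If it swaps them,
  the rearranged matrix is the transpose of \<open>X\<close>.\<close>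

lemma collinearity_preserving_permutation_trivial:
  assumes m: "2 \<le> m" and n: "2 \<le> n" and perm: "\<pi> permutes ({..<m} \<times> {..<n})"
    and pres: "\<And>p q. p \<in> {..<m} \<times> {..<n} \<Longrightarrow> q \<in> {..<m} \<times> {..<n} \<Longrightarrow>
      collinear (\<pi> p) (\<pi> q) \<Longrightarrow> collinear p q"
    and X: "X \<in> carrier_mat m n"
  shows "\<exists>P Q. permutation_matrix m P \<and> permutation_matrix n Q \<and>
    (permute_entries \<pi> X = P * X * Q \<or> m = n \<and> permute_entries \<pi> X = P * X\<^sup>T * Q)"
proof -
  have range: "fst (\<pi> (i, j)) < m \<and> snd (\<pi> (i, j)) < n" if "i < m" "j < n" for i j
    using permutes_in_image[OF perm, of "(i, j)"] that by (auto simp: mem_Times_iff)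
  have inj: "\<pi> p = \<pi> q \<longleftrightarrow> p = q" for p q
    using permutes_inj[OF perm] by (simp add: inj_eq)
  have col: "collinear (\<pi> p) (\<pi> q) \<longleftrightarrow> collinear p q"
    if "p \<in> {..<m} \<times> {..<n}" "q \<in> {..<m} \<times> {..<n}" for p q
    by (rule collinear_iff_permutes[OF perm _ pres that]) auto
  obtain s t where
    st: "(\<forall>i<m. \<forall>j<n. \<pi> (i, j) = (s i, t j)) \<or> (\<forall>i<m. \<forall>j<n. \<pi> (i, j) = (t j, s i))"
    using grid_collinear_automorphism[OF m n col] by blast
  have s: "inj_on s {..<m}"
  proof (rule inj_onI)
    fix i i' assume "i \<in> {..<m}" "i' \<in> {..<m}" "s i = s i'"
    then have "\<pi> (i, 0) = \<pi> (i', 0)" using st n by auto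
    then show "i = i'" by (simp add: inj)
  qed
  have t: "inj_on t {..<n}"
  proof (rule inj_onI)
    fix j j' assume "j \<in> {..<n}" "j' \<in> {..<n}" "t j = t j'"
    then have "\<pi> (0, j) = \<pi> (0, j')" using st m by auto
    then show "j = j'" by (simp add: inj)
  qed
  from st consider (straight) "\<And>i j. i < m \<Longrightarrow> j < n \<Longrightarrow> \<pi> (i, j) = (s i, t j)"
    | (transposed) "\<And>i j. i < m \<Longrightarrow> j < n \<Longrightarrow> \<pi> (i, j) = (t j, s i)"
    by blast
  then show ?thesis
  proof cases
    case straight
    have "s i < m" if "i < m" for i using range[of i 0] straight[of i 0] that n by simp
    then have s': "s ` {..<m} \<subseteq> {..<m}" by auto
    have "t j < n" if "j < n" for j using range[of 0 j] straight[of 0 j] that m by simp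
    then have t': "t ` {..<n} \<subseteq> {..<n}" by auto
    have "permute_entries \<pi> X = mat m n (\<lambda>(i, j). X $$ (s i, t j))"
      using X straight unfolding permute_entries_def by (intro cong_mat) auto
    then show ?thesis
      using rearrangement_eq_permutation_matrices[OF s s' t t' X] by metis
  next
    case transposed
    have si: "s i < n" if "i < m" for i using range[of i 0] transposed[of i 0] that n by simp
    then have s': "s ` {..<m} \<subseteq> {..<n}" by auto
    have tj: "t j < m" if "j < n" for j using range[of 0 j] transposed[of 0 j] that m by simp
    then have t': "t ` {..<n} \<subseteq> {..<m}" by auto
    \<comment> \<open>\<open>s\<close> injects row indices into column indices, and \<open>t\<close>
      column indices into row indices.\<close>
    have mn: "m = n"
      using card_inj_on_le[OF s s'] card_inj_on_le[OF t t'] by simp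
    have "permute_entries \<pi> X = mat m n (\<lambda>(i, j). X\<^sup>T $$ (s i, t j))"
      using X transposed si tj unfolding permute_entries_def by (intro cong_mat) auto
    moreover have "X\<^sup>T \<in> carrier_mat m n" using X mn by simp
    ultimately show ?thesis
      using rearrangement_eq_permutation_matrices[OF s _ t, of "X\<^sup>T"] s' t' unfolding mn by metis
  qed
qed

section \<open>Permutations that create collinear pairs\<close>

text \<open>Used once for rows and once for columns, to extend two noncollinear cells to a
  transversal of \<open>r + 1\<close> cells.\<close>

lemma injection_with_prescribed_start:
  fixes a b k r :: nat
  assumes "a < k" "b < k" "a \<noteq> b" "r < k" "0 < r"
  shows "\<exists>f. inj_on f {..r} \<and> f ` {..r} \<subseteq> {..<k} \<and> f 0 = a \<and> f 1 = b"
proof -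
  \<comment> \<open>The first transposition sends 0 to \<open>a\<close> and 1 to \<open>c\<close>.
    The second sends \<open>c\<close> to \<open>b\<close> and fixes \<open>a\<close>, which differs
    from both.\<close>
  define c where "c = transpose 0 a 1"
  define f where "f = transpose c b \<circ> transpose 0 a"
  have less: "transpose x y z < k" if "x < k" "y < k" "z < k" for x y z
    using that by (cases "z = x"; cases "z = y") simp_all
  have "c \<noteq> a"
    using transpose_eq_imp_eq[of 0 a 1 0] by (auto simp: c_def)
  then have "f 0 = a" using assms(3) by (simp add: f_def)
  moreover have "f 1 = b" by (simp only: f_def c_def o_apply transpose_apply_first)
  moreover have "inj f" unfolding f_def by (intro inj_compose) auto
  moreover have "c < k" unfolding c_def using assms by (intro less) simp_all
  then have "f ` {..r} \<subseteq> {..<k}"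
    using assms less by (force simp: f_def)
  ultimately show ?thesis by (intro exI[of _ f]) (auto intro: inj_on_subset)
qed

text \<open>A sum of \<open>r + 1\<close> matrix units, two of which share a row or a column: these
  two merge into one outer product, leaving \<open>r\<close> of them.\<close>

lemma collinear_support_in_rank_variety:
  assumes r: "0 < r" and coll: "collinear (T 0) (T 1)"
  shows "mat m n (\<lambda>(i, j). \<Sum>k\<le>r. if T k = (i, j) then 1 else 0) \<in> rank_variety r m n"
proof -
  obtain q where q: "r = Suc q" using r by (cases r) auto
  have split: "(\<Sum>k\<le>r. h k) = h 0 + (\<Sum>k<r. h (Suc k))" for h :: "nat \<Rightarrow> real"
    unfolding lessThan_Suc_atMost[symmetric] by (rule sum.lessThan_Suc_shift)
  have first: "(\<Sum>k<r. h k) = h 0 + (\<Sum>k<q. h (Suc k))" for h :: "nat \<Rightarrow> real"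
    unfolding q by (rule sum.lessThan_Suc_shift)
  show ?thesis
  proof (cases "fst (T 0) = fst (T 1)")
    case True
    let ?c = "\<lambda>i k. if fst (T (Suc k)) = i then 1 else 0 :: real"
    \<comment> \<open>Product \<open>k\<close> represents the cell \<open>T (Suc k)\<close>. The
      extra term at \<open>k = 0\<close> adds \<open>T 0\<close>, which lies in the row of
      \<open>T 1\<close>.\<close>
    let ?d = "\<lambda>k j. (if snd (T (Suc k)) = j then 1 else 0) + (if k = 0 \<and> snd (T 0) = j then 1 else 0) :: real"
    have "mat m n (\<lambda>(i, j). \<Sum>k\<le>r. if T k = (i, j) then 1 else 0) = sum_of_products r m n ?c ?d"
      unfolding sum_of_products_def split first using True
      by (intro cong_mat) (auto simp: prod_eq_iff intro!: sum.cong)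
    then show ?thesis unfolding rank_variety_iff by blast
  next
    case False
    then have snd: "snd (T 0) = snd (T 1)" using coll by (simp add: collinear_def)
    let ?d = "\<lambda>k j. if snd (T (Suc k)) = j then 1 else 0 :: real"
    let ?c = "\<lambda>i k. (if fst (T (Suc k)) = i then 1 else 0) + (if k = 0 \<and> fst (T 0) = i then 1 else 0) :: real"
    have "mat m n (\<lambda>(i, j). \<Sum>k\<le>r. if T k = (i, j) then 1 else 0) = sum_of_products r m n ?c ?d"
      unfolding sum_of_products_def split first using snd
      by (intro cong_mat) (auto simp: prod_eq_iff intro!: sum.cong)
    then show ?thesis unfolding rank_variety_iff by blast
  qed
qed

lemma rank_increasing_polynomial:
  assumes r: "0 < r" "r < min m n" and perm: "\<pi> permutes ({..<m} \<times> {..<n})"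
    and pq: "p \<in> {..<m} \<times> {..<n}" "q \<in> {..<m} \<times> {..<n}" "collinear (\<pi> p) (\<pi> q)" "\<not> collinear p q"
  shows "\<exists>g \<in> entry_polynomials m n. (\<exists>X \<in> rank_variety r m n. g X \<noteq> 0) \<and>
    (\<forall>X \<in> carrier_mat m n. g X \<noteq> 0 \<longrightarrow> mat_rank (permute_entries \<pi> X) > r)"
proof -
  obtain e where e: "inj_on e {..r}" "e ` {..r} \<subseteq> {..<m}" "e 0 = fst p" "e 1 = fst q"
    using injection_with_prescribed_start[of "fst p" m "fst q" r] pq r
    by (auto simp: collinear_def)
  obtain f where f: "inj_on f {..r}" "f ` {..r} \<subseteq> {..<n}" "f 0 = snd p" "f 1 = snd q"
    using injection_with_prescribed_start[of "snd p" n "snd q" r] pq r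
    by (auto simp: collinear_def)
  have em: "e k < m" and fn: "f k < n" if "k \<le> r" for k using e(2) f(2) that by auto
  have pi: "fst (\<pi> (e k, f l)) < m" "snd (\<pi> (e k, f l)) < n" if "k \<le> r" "l \<le> r" for k l
    using permutes_in_image[OF perm, of "(e k, f l)"] em fn that by (auto simp: mem_Times_iff)
  \<comment> \<open>The minor of \<open>permute_entries \<pi> X\<close> on rows \<open>e\<close> and
    columns \<open>f\<close>, expressed through the entries of \<open>X\<close>.\<close>
  define g where "g X = det (mat (Suc r) (Suc r) (\<lambda>(k, l). X $$ \<pi> (e k, f l)))" for X :: "real mat"
  have "(\<lambda>X. X $$ \<pi> (e k, f l)) \<in> entry_polynomials m n" if "k < Suc r" "l < Suc r" for k l
    using entry_polynomials.entry[of "fst (\<pi> (e k, f l))" m "snd (\<pi> (e k, f l))" n] pi that by simp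
  then have poly: "g \<in> entry_polynomials m n"
    unfolding g_def by (intro entry_polynomials_det)
  have rank: "mat_rank (permute_entries \<pi> X) > r" if X: "X \<in> carrier_mat m n" "g X \<noteq> 0" for X
  proof (rule det_nonzero_imp_rank_gt[of _ m n r e f])
    have "mat (Suc r) (Suc r) (\<lambda>(k, l). permute_entries \<pi> X $$ (e k, f l)) =
      mat (Suc r) (Suc r) (\<lambda>(k, l). X $$ \<pi> (e k, f l))"
      using X em fn by (intro cong_mat) (auto simp: permute_entries_def less_Suc_eq_le)
    then show "det (mat (Suc r) (Suc r) (\<lambda>(k, l). permute_entries \<pi> X $$ (e k, f l))) \<noteq> 0"
      using X by (simp add: g_def)
  qed (use X em fn in \<open>auto simp: permute_entries_def\<close>)
  let ?T = "\<lambda>k. \<pi> (e k, f k)"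
  let ?X = "mat m n (\<lambda>(i, j). \<Sum>k\<le>r. if ?T k = (i, j) then 1 else 0 :: real)"
  \<comment> \<open>\<open>?T 0\<close> and \<open>?T 1\<close> are the images of \<open>p\<close>
    and \<open>q\<close>, which are collinear by assumption.\<close>
  have "?X \<in> rank_variety r m n"
    using pq(3) e f by (intro collinear_support_in_rank_variety r) simp
  moreover have "mat (Suc r) (Suc r) (\<lambda>(k, l). ?X $$ \<pi> (e k, f l)) = 1\<^sub>m (Suc r)"
  proof (rule eq_matI)
    fix k l assume "k < dim_row (1\<^sub>m (Suc r) :: real mat)" "l < dim_col (1\<^sub>m (Suc r) :: real mat)"
    then have kl: "k \<le> r" "l \<le> r" by auto
    \<comment> \<open>By injectivity of \<open>\<pi>\<close>, \<open>e\<close> and \<open>f\<close>,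
      the only cells of the minor that meet the support of \<open>?X\<close> are the diagonal
      ones.\<close>
    have hit: "?T h = \<pi> (e k, f l) \<longleftrightarrow> h = k \<and> h = l" if "h \<le> r" for h
      using permutes_inj[OF perm] e(1) f(1) kl that by (auto simp: inj_eq inj_on_eq_iff)
    have "?X $$ \<pi> (e k, f l) = ?X $$ (fst (\<pi> (e k, f l)), snd (\<pi> (e k, f l)))" by simp
    also have "\<dots> = (\<Sum>h\<le>r. if ?T h = \<pi> (e k, f l) then 1 else 0)"
      using pi[OF kl] by (subst index_mat) auto
    also have "\<dots> = (\<Sum>h\<le>r. if h = k then (if k = l then 1 else 0) else 0)"
      using hit by (intro sum.cong) auto
    also have "\<dots> = (if k = l then 1 else 0)" using kl by (subst sum.delta) auto
    finally show "mat (Suc r) (Suc r) (\<lambda>(k, l). ?X $$ \<pi> (e k, f l)) $$ (k, l) =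
      (1\<^sub>m (Suc r) :: real mat) $$ (k, l)"
      using kl by simp
  qed auto
  then have "g ?X \<noteq> 0" unfolding g_def by (simp only: det_one)
  ultimately show ?thesis using poly rank by blast
qed

section \<open>Generic properties from a single nonvanishing polynomial\<close>

lemma generic_of_rankI:
  assumes g: "g \<in> entry_polynomials m n" and X: "X \<in> rank_variety r m n" "g X \<noteq> 0"
    and P: "\<And>X. X \<in> rank_variety r m n \<Longrightarrow> g X \<noteq> 0 \<Longrightarrow> P X"
  shows "generic_of_rank r m n P"
proof -
  let ?Z = "{X \<in> carrier_mat m n. g X = 0}"
  have "zariski_closed m n ?Z"
    unfolding zariski_closed_def using g by (intro exI[of _ "{g}"]) auto
  then have "zariski_open_in m n (rank_variety r m n) (rank_variety r m n - ?Z)"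
    unfolding zariski_open_in_def by blast
  moreover have "X \<in> rank_variety r m n - ?Z" using X by simp
  moreover have "P X" if "X \<in> rank_variety r m n - ?Z" for X
    using that by (intro P) (auto simp: rank_variety_def)
  ultimately show ?thesis unfolding generic_of_rank_def by blast
qed

theorem theorem1:
  fixes m n r :: nat
  assumes "m > 0" and "n > 0" and "r < min m n"
  shows "generic_of_rank r m n (\<lambda>X.
    \<forall>\<pi>. \<pi> permutes ({..<m} \<times> {..<n}) \<longrightarrow>
      \<not> (\<exists>P Q. permutation_matrix m P \<and> permutation_matrix n Q \<and>
          (permute_entries \<pi> X = P * X * Q \<or>
           m = n \<and> permute_entries \<pi> X = P * X\<^sup>T * Q)) \<longrightarrow>
      mat_rank (permute_entries \<pi> X) > r)"
proof (cases "r = 0")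
  \<comment> \<open>For \<open>r = 0\<close> the variety consists of the zero matrix, which every
    permutation fixes, so all permutations are exceptional. The main argument needs transversals
    with at least two cells.\<close>
  case True
  show ?thesis
  proof (rule generic_of_rankI[of "\<lambda>X. 1"])
    show "sum_of_products r m n (\<lambda>_ _. 0) (\<lambda>_ _. 0) \<in> rank_variety r m n"
      unfolding rank_variety_iff by blast
  next
    fix X assume "X \<in> rank_variety r m n"
    then have X: "X = 0\<^sub>m m n"
      using True by (auto simp: rank_variety_iff sum_of_products_def)
    have "\<exists>P Q. permutation_matrix m P \<and> permutation_matrix n Q \<and>
      permute_entries \<pi> X = P * X * Q" if "\<pi> permutes ({..<m} \<times> {..<n})" for \<pi>
    proof -
      have "X $$ \<pi> (i, j) = X $$ (i, j)" if ij: "i < m" "j < n" for i j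
      proof -
        have "\<pi> (i, j) \<in> {..<m} \<times> {..<n}"
          using permutes_in_image[OF \<open>\<pi> permutes _\<close>, of "(i, j)"] ij by simp
        then obtain i' j' where "\<pi> (i, j) = (i', j')" "i' < m" "j' < n" by auto
        then show ?thesis using X ij by simp
      qed
      moreover have carrier: "X \<in> carrier_mat m n" using X by simp
      ultimately have "permute_entries \<pi> X = mat m n (\<lambda>(i, j). X $$ (id i, id j))"
        unfolding permute_entries_def by (intro cong_mat) auto
      moreover have "inj_on id {..<k}" "id ` {..<k} \<subseteq> {..<k}" for k :: nat by simp_all
      ultimately show ?thesis
        using rearrangement_eq_permutation_matrices[OF _ _ _ _ carrier, of id id] by metis
    qed
    then show "\<forall>\<pi>. \<pi> permutes ({..<m} \<times> {..<n}) \<longrightarrow>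
      \<not> (\<exists>P Q. permutation_matrix m P \<and> permutation_matrix n Q \<and>
          (permute_entries \<pi> X = P * X * Q \<or>
           m = n \<and> permute_entries \<pi> X = P * X\<^sup>T * Q)) \<longrightarrow>
      mat_rank (permute_entries \<pi> X) > r" by blast
  qed (auto intro: entry_polynomials.const)
next
  case False
  then have r: "0 < r" by simp
  let ?G = "{..<m} \<times> {..<n}"
  \<comment> \<open>\<open>B\<close> is finite and depends on the grid alone, so the open set can be
    fixed before \<open>X\<close> and \<open>\<pi>\<close> are given.\<close>
  define B where "B = {\<pi>. \<pi> permutes ?G \<and>
    (\<exists>p\<in>?G. \<exists>q\<in>?G. collinear (\<pi> p) (\<pi> q) \<and> \<not> collinear p q)}"
  have fin: "finite B"
    by (rule finite_subset[OF _ finite_permutations[of ?G]]) (auto simp: B_def)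
  have "\<forall>\<pi>\<in>B. \<exists>g. g \<in> entry_polynomials m n \<and> (\<exists>X \<in> rank_variety r m n. g X \<noteq> 0) \<and>
    (\<forall>X \<in> carrier_mat m n. g X \<noteq> 0 \<longrightarrow> mat_rank (permute_entries \<pi> X) > r)"
  proof
    fix \<pi> assume "\<pi> \<in> B"
    then obtain p q where "\<pi> permutes ?G" "p \<in> ?G" "q \<in> ?G" "collinear (\<pi> p) (\<pi> q)" "\<not> collinear p q"
      unfolding B_def by blast
    then show "\<exists>g. g \<in> entry_polynomials m n \<and> (\<exists>X \<in> rank_variety r m n. g X \<noteq> 0) \<and>
        (\<forall>X \<in> carrier_mat m n. g X \<noteq> 0 \<longrightarrow> mat_rank (permute_entries \<pi> X) > r)"
      using rank_increasing_polynomial[OF r assms(3), of \<pi> p q] by (simp add: Bex_def)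
  qed
  from bchoice[OF this] obtain g where g: "\<And>\<pi>. \<pi> \<in> B \<Longrightarrow> g \<pi> \<in> entry_polynomials m n"
    "\<And>\<pi>. \<pi> \<in> B \<Longrightarrow> \<exists>X \<in> rank_variety r m n. g \<pi> X \<noteq> 0"
    "\<And>\<pi> X. \<pi> \<in> B \<Longrightarrow> X \<in> carrier_mat m n \<Longrightarrow> g \<pi> X \<noteq> 0 \<Longrightarrow> mat_rank (permute_entries \<pi> X) > r"
    by auto
  obtain X0 where X0: "X0 \<in> rank_variety r m n" "(\<Prod>\<pi>\<in>B. g \<pi> X0) \<noteq> 0"
    using rank_variety_prod_nonzero[of B g, OF fin g(1) g(2)] by blast
  show ?thesis
  proof (rule generic_of_rankI[where g = "\<lambda>X. \<Prod>\<pi>\<in>B. g \<pi> X", OF _ X0], goal_cases)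
    case 1
    show ?case using fin g(1) by (rule entry_polynomials_prod)
  next
    case (2 X)
    then have X: "X \<in> carrier_mat m n" by (simp add: rank_variety_def)
    show ?case
    proof (intro allI impI)
      fix \<pi> assume pi: "\<pi> permutes ?G" and nontrivial: "\<not> (\<exists>P Q. permutation_matrix m P \<and>
        permutation_matrix n Q \<and> (permute_entries \<pi> X = P * X * Q \<or>
          m = n \<and> permute_entries \<pi> X = P * X\<^sup>T * Q))"
      have "2 \<le> m" "2 \<le> n" using r assms(3) by auto
      \<comment> \<open>Outside \<open>B\<close> noncollinear cells stay noncollinear, which makes
        \<open>\<pi>\<close> exceptional for every \<open>X\<close>, against
        \<open>nontrivial\<close>.\<close>
      have "\<pi> \<in> B"
      proof (rule ccontr)
        assume "\<pi> \<notin> B"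
        then have "collinear p q" if "p \<in> ?G" "q \<in> ?G" "collinear (\<pi> p) (\<pi> q)" for p q
          using pi that unfolding B_def by blast
        then show False
          using collinearity_preserving_permutation_trivial[OF \<open>2 \<le> m\<close> \<open>2 \<le> n\<close> pi _ X] nontrivial
          by metis
      qed
      moreover from this have "g \<pi> X \<noteq> 0"
        using 2(2) fin by (auto simp: prod_zero_iff)
      ultimately show "mat_rank (permute_entries \<pi> X) > r"
        using g(3) X by blast
    qed
  qed
qed

end
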